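(* For $y\in[0,1]$ put $p_1(y)=(y^2,y,0)$, $p_2(y)=(y^2/4,y,0)$, $q_1(y)=(-y^2,y,0)$, $q_2(y)=(-y^2/4,y,0)$ (these are the points at height $y$ on the curves $y=\sqrt{x}$, $y=2\sqrt{x}$, $y=\sqrt{-x}$, $y=2\sqrt{-x}$ in the plane $z=0$). Define $$X_1=\Big\{(x,y,z)\in\mathbb{R}\times[0,1]\times\mathbb{R} \;:\; \Big\|(x,y,z)-\tfrac{p_1(y)+p_2(y)}{2}\Big\|=\Big\|p_2(y)-\tfrac{p_1(y)+p_2(y)}{2}\Big\|\Big\},$$ $$X_2=\Big\{(x,y,z)\in\mathbb{R}\times[0,1]\times\mathbb{R} \;:\; \Big\|(x,y,z)-\tfrac{q_1(y)+q_2(y)}{2}\Big\|=\Big\|q_2(y)-\tfrac{q_1(y)+q_2(y)}{2}\Big\|\Big\},$$ $$X_3=\Big\{(x,y,0) \;:\; x\in[-\tfrac12,\tfrac12],\; y\in[0,1],\; |y|>2\sqrt{|x|}\Big\},$$ and let $X=X_1\cup X_2\cup X_3\subset\mathbb{R}^3$. Then $X$ is Lipschitz normally embedded, but its medial axis $M_X$ is not Lipschitz normally embedded.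
   Context: $\|\cdot\|$ denotes the Euclidean norm. For a semialgebraic set $Y\subset\mathbb{R}^n$ and $y_1,y_2\in Y$, the induced metric is $d_{ind}(y_1,y_2)=\|y_1-y_2\|$, and the length (inner) metric $d_l(y_1,y_2)$ is the infimum of the lengths of rectifiable paths in $Y$ joining $y_1$ to $y_2$ (equal to $+\infty$ if there is no such path). The set $Y$ is called Lipschitz normally embedded (LNE) if there exists $C>0$ such that $d_l(y_1,y_2)\le C\,d_{ind}(y_1,y_2)$ for all $y_1,y_2\in Y$. For a closed nonempty set $X\subset\mathbb{R}^n$ and $x\in\mathbb{R}^n$, let $m(x)=\{a\in X : \|a-x\|=d(x,X)\}$ be the set of closest points to $x$ in $X$, where $d(x,X)=\inf_{a\in X}\|x-a\|$. The medial axis of $X$ is $M_X=\{x\in\mathbb{R}^n\setminus X : \#m(x)>1\}$. *)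

theory Defs
  imports "HOL-Analysis.Analysis"
begin

(* The length of a path (parametrised over {0..1}) as the supremum of the lengths
   of its inscribed polygons; it is \<infinity> for a non-rectifiable path. *)
definition partition01 :: "nat \<Rightarrow> (nat \<Rightarrow> real) \<Rightarrow> bool" where
  "partition01 n t \<longleftrightarrow> t 0 = 0 \<and> t n = 1 \<and> (\<forall>i<n. t i \<le> t (Suc i))"

definition path_length :: "(real \<Rightarrow> 'a::metric_space) \<Rightarrow> ennreal" where
  "path_length g =
     (SUP (n, t) \<in> {(n, t). partition01 n t}. \<Sum>i<n. ennreal (dist (g (t i)) (g (t (Suc i)))))"

definition rectifiable_path :: "(real \<Rightarrow> 'a::metric_space) \<Rightarrow> bool" where
  "rectifiable_path g \<longleftrightarrow> path g \<and> path_length g < \<infinity>"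

(* The infimum of the empty set in ennreal is \<infinity>, as wanted for points that
   no rectifiable path in Y joins. *)
definition length_dist :: "'a::metric_space set \<Rightarrow> 'a \<Rightarrow> 'a \<Rightarrow> ennreal" where
  "length_dist Y a b =
     (INF g \<in> {g. rectifiable_path g \<and> path_image g \<subseteq> Y \<and> pathstart g = a \<and> pathfinish g = b}.
        path_length g)"

(* Stated for arbitrary sets: semialgebraicity plays no role in the condition itself. *)
definition lipschitz_normally_embedded :: "'a::metric_space set \<Rightarrow> bool" where
  "lipschitz_normally_embedded Y \<longleftrightarrow>
     (\<exists>C>0. \<forall>a\<in>Y. \<forall>b\<in>Y. length_dist Y a b \<le> ennreal (C * dist a b))"

definition closest_points :: "'a::metric_space set \<Rightarrow> 'a \<Rightarrow> 'a set" where
  "closest_points X x = {a \<in> X. dist a x = infdist x X}"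

(* "More than one element" is not written with card, which is 0 on infinite sets. *)
definition medial_axis :: "'a::metric_space set \<Rightarrow> 'a set" where
  "medial_axis X =
     {x. x \<notin> X \<and> (\<exists>a\<in>closest_points X x. \<exists>b\<in>closest_points X x. a \<noteq> b)}"

definition p1 :: "real \<Rightarrow> real^3" where "p1 y = vector [y\<^sup>2, y, 0]"
definition p2 :: "real \<Rightarrow> real^3" where "p2 y = vector [y\<^sup>2 / 4, y, 0]"
definition q1 :: "real \<Rightarrow> real^3" where "q1 y = vector [- y\<^sup>2, y, 0]"
definition q2 :: "real \<Rightarrow> real^3" where "q2 y = vector [- y\<^sup>2 / 4, y, 0]"

definition X1 :: "(real^3) set" where
  "X1 = {v. \<exists>x y z. v = vector [x, y, z] \<and> y \<in> {0..1} \<and>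
          norm (v - midpoint (p1 y) (p2 y)) = norm (p2 y - midpoint (p1 y) (p2 y))}"

definition X2 :: "(real^3) set" where
  "X2 = {v. \<exists>x y z. v = vector [x, y, z] \<and> y \<in> {0..1} \<and>
          norm (v - midpoint (q1 y) (q2 y)) = norm (q2 y - midpoint (q1 y) (q2 y))}"

definition X3 :: "(real^3) set" where
  "X3 = {v. \<exists>x y. v = vector [x, y, 0] \<and> x \<in> {-1/2..1/2} \<and> y \<in> {0..1} \<and>
          \<bar>y\<bar> > 2 * sqrt \<bar>x\<bar>}"

end

theory Submission
  imports Defs
begin

text \<open>The set is swept out by the planar curve "two circles joined by a segment", scaled by \<open>y\<^sup>2\<close> at
  height \<open>y\<close>. Two of its points are joined by first changing the height along the sweep and then
  moving in a slice, which is short because the planar curve is Lipschitz normally embedded. The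
  medial axis, on the other hand, has points inside both tubes at every height \<open>y\<close>, at distance at
  most \<open>2 y\<^sup>2\<close>. As it avoids the set, a path in it leaving a tube has to pass through the open end
  \<open>y = 1\<close>, so its length is at least \<open>1 - y\<close>.\<close>

section \<open>Sets whose points are joined by short Lipschitz paths\<close>

text \<open>A Lipschitz constant over the unit interval stands in for the length. It bounds the
  length from above and behaves simply under reversal, concatenation and composition with Lipschitz
  maps.\<close>

definition lip_joined :: "'a::metric_space set \<Rightarrow> real \<Rightarrow> 'a \<Rightarrow> 'a \<Rightarrow> bool" where
  "lip_joined S L a b \<longleftrightarrow>
     (\<exists>g. L-lipschitz_on {0..1::real} g \<and> g ` {0..1} \<subseteq> S \<and> g 0 = a \<and> g 1 = b)"

lemma lip_joined_mono:
  assumes "lip_joined S L a b" "S \<subseteq> T" "L \<le> M"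
  shows "lip_joined T M a b"
  using assms unfolding lip_joined_def by (blast intro: lipschitz_on_mono)

lemma lip_joined_sym:
  assumes "lip_joined S L a b"
  shows "lip_joined S L b a"
proof -
  obtain g where g: "L-lipschitz_on {0..1::real} g" "g ` {0..1} \<subseteq> S" "g 0 = a" "g 1 = b"
    using assms unfolding lip_joined_def by blast
  have "L-lipschitz_on {0..1} (\<lambda>t. g (1 - t))"
  proof (rule lipschitz_onI)
    fix s t :: real assume "s \<in> {0..1}" "t \<in> {0..1}"
    then show "dist (g (1 - s)) (g (1 - t)) \<le> L * dist s t"
      using lipschitz_onD[OF g(1), of "1 - s" "1 - t"]
      by (simp add: dist_real_def abs_minus_commute)
  qed (rule lipschitz_on_nonneg[OF g(1)])
  then show ?thesis
    unfolding lip_joined_def using g by (intro exI[of _ "\<lambda>t. g (1 - t)"]) auto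
qed

text \<open>Each path is run at double speed on one half of the interval, hence the factor
  2.\<close>

lemma lip_joined_trans:
  assumes "lip_joined S L a b" "lip_joined S L b c"
  shows "lip_joined S (2 * L) a c"
proof -
  obtain g where g: "L-lipschitz_on {0..1::real} g" "g ` {0..1} \<subseteq> S" "g 0 = a" "g 1 = b"
    using assms(1) unfolding lip_joined_def by blast
  obtain h where h: "L-lipschitz_on {0..1::real} h" "h ` {0..1} \<subseteq> S" "h 0 = b" "h 1 = c"
    using assms(2) unfolding lip_joined_def by blast
  have L: "0 \<le> L" using g(1) by (rule lipschitz_on_nonneg)
  have dist_double: "dist (2 * s) (2 * t) = 2 * dist s t"
    "dist (2 * s - 1) (2 * t - 1) = 2 * dist s t" for s t :: real
    by (auto simp: dist_real_def abs_if)
  let ?k = "\<lambda>t. if t \<le> 1/2 then g (2 * t) else h (2 * t - 1)"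
  have "(2 * L)-lipschitz_on {0..1/2} (\<lambda>t. g (2 * t))"
  proof (rule lipschitz_onI)
    fix s t :: real assume "s \<in> {0..1/2}" "t \<in> {0..1/2}"
    then show "dist (g (2 * s)) (g (2 * t)) \<le> 2 * L * dist s t"
      using lipschitz_onD[OF g(1), of "2 * s" "2 * t"] dist_double by simp
  qed (use L in simp)
  moreover have "(2 * L)-lipschitz_on {1/2..1} (\<lambda>t. h (2 * t - 1))"
  proof (rule lipschitz_onI)
    fix s t :: real assume "s \<in> {1/2..1}" "t \<in> {1/2..1}"
    then show "dist (h (2 * s - 1)) (h (2 * t - 1)) \<le> 2 * L * dist s t"
      using lipschitz_onD[OF h(1), of "2 * s - 1" "2 * t - 1"] dist_double by simp
  qed (use L in simp)
  ultimately have "(2 * L)-lipschitz_on {0..1} ?k"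
    by (rule lipschitz_on_concat) (use g h in simp)
  moreover have "?k ` {0..1} \<subseteq> S"
    using g(2) h(2) by (auto simp: image_subset_iff)
  ultimately show ?thesis
    unfolding lip_joined_def using g h by (intro exI[of _ ?k]) auto
qed

lemma lip_joined_image:
  assumes "lip_joined S L a b" "K-lipschitz_on S f" "f ` S \<subseteq> T"
  shows "lip_joined T (K * L) (f a) (f b)"
proof -
  obtain g where g: "L-lipschitz_on {0..1::real} g" "g ` {0..1} \<subseteq> S" "g 0 = a" "g 1 = b"
    using assms(1) unfolding lip_joined_def by blast
  have "(K * L)-lipschitz_on {0..1} (\<lambda>t. f (g t))"
    by (rule lipschitz_on_compose2[OF g(1)]) (use g assms lipschitz_on_subset in blast)
  then show ?thesis
    unfolding lip_joined_def using g assms(3) by (intro exI[of _ "\<lambda>t. f (g t)"]) auto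
qed

text \<open>The edges of an inscribed polygon are at most \<open>L\<close> times the gaps of the
  partition, and the gaps telescope to 1.\<close>

lemma path_length_lipschitz:
  assumes "L-lipschitz_on {0..1} g"
  shows "path_length g \<le> ennreal L"
  unfolding path_length_def
proof (rule SUP_least, clarify)
  fix n t assume p: "partition01 n t"
  \<comment> \<open>\<open>partition01\<close> compares neighbouring nodes only. Monotonicity over
    all indices places every node in the unit interval, where the Lipschitz bound is
    available.\<close>
  have mono: "t i \<le> t j" if "i \<le> j" "j \<le> n" for i j
    using that(2,1)
  proof (induction j)
    case (Suc j)
    then show ?case
      using p by (cases "i = Suc j") (auto simp: partition01_def intro: order_trans)
  qed auto
  have t01: "t i \<in> {0..1}" if "i \<le> n" for i
    using mono[of 0 i] mono[of i n] that p by (auto simp: partition01_def)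
  have "(\<Sum>i<n. ennreal (dist (g (t i)) (g (t (Suc i))))) \<le> (\<Sum>i<n. ennreal (L * (t (Suc i) - t i)))"
  proof (intro sum_mono ennreal_leI)
    fix i assume "i \<in> {..<n}"
    then show "dist (g (t i)) (g (t (Suc i))) \<le> L * (t (Suc i) - t i)"
      using lipschitz_onD[OF assms t01[of i] t01[of "Suc i"]] mono[of i "Suc i"]
      by (simp add: dist_real_def)
  qed
  also have "\<dots> = ennreal (\<Sum>i<n. L * (t (Suc i) - t i))"
    using lipschitz_on_nonneg[OF assms] mono by (intro sum_ennreal) auto
  also have "(\<Sum>i<n. L * (t (Suc i) - t i)) = L"
    using p by (simp add: sum_lessThan_telescope partition01_def flip: sum_distrib_left)
  finally show "(\<Sum>i<n. ennreal (dist (g (t i)) (g (t (Suc i))))) \<le> ennreal L" .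
qed

lemma length_dist_lip_joined:
  assumes "lip_joined S L a b"
  shows "length_dist S a b \<le> ennreal L"
proof -
  obtain g where g: "L-lipschitz_on {0..1::real} g" "g ` {0..1} \<subseteq> S" "g 0 = a" "g 1 = b"
    using assms unfolding lip_joined_def by blast
  have "rectifiable_path g"
    using path_length_lipschitz[OF g(1)] lipschitz_on_continuous_on[OF g(1)]
    by (auto simp: rectifiable_path_def path_def intro: le_less_trans)
  then show ?thesis
    unfolding length_dist_def
    by (intro INF_lower2[of g] path_length_lipschitz g)
       (use g in \<open>auto simp: path_image_def pathstart_def pathfinish_def\<close>)
qed

text \<open>A quantitative form of Lipschitz normal embedding, with the constant exposed so that it
  can be tracked through gluing and sweeping.\<close>

definition lip_connected :: "real \<Rightarrow> 'a::metric_space set \<Rightarrow> bool" where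
  "lip_connected K S \<longleftrightarrow> (\<forall>a\<in>S. \<forall>b\<in>S. lip_joined S (K * dist a b) a b)"

lemma lip_connected_imp_lipschitz_normally_embedded:
  assumes "lip_connected K S" "0 < K"
  shows "lipschitz_normally_embedded S"
  using assms unfolding lip_connected_def lipschitz_normally_embedded_def
  by (blast intro: length_dist_lip_joined)

lemma lip_connected_mono:
  assumes "lip_connected K S" "K \<le> M"
  shows "lip_connected M S"
  using assms unfolding lip_connected_def
  by (meson lip_joined_mono mult_right_mono order_refl zero_le_dist)

lemma lip_connected_convex:
  fixes S :: "'a::real_normed_vector set"
  assumes "convex S"
  shows "lip_connected 1 S"
  unfolding lip_connected_def
proof (intro ballI)
  fix a b assume ab: "a \<in> S" "b \<in> S"
  have "(dist a b)-lipschitz_on {0..1} (linepath a b)"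
  proof (rule lipschitz_onI)
    fix s t :: real
    have "linepath a b s - linepath a b t = (s - t) *\<^sub>R (b - a)"
      by (simp add: linepath_def algebra_simps)
    then show "dist (linepath a b s) (linepath a b t) \<le> dist a b * dist s t"
      by (simp add: dist_norm norm_minus_commute mult.commute)
  qed simp
  moreover have "linepath a b ` {0..1} \<subseteq> S"
    using ab assms by (metis closed_segment_subset linepath_image_01)
  ultimately show "lip_joined S (1 * dist a b) a b"
    unfolding lip_joined_def
    by (intro exI[of _ "linepath a b"]) (auto simp: linepath_def)
qed

text \<open>Points in different pieces are joined through the common point \<open>p\<close>. By
  \<open>le\<close>, both legs of this detour are at most \<open>M\<close> times the direct
  distance, and concatenating them costs the factor 2.\<close>

lemma lip_connected_Un:
  assumes A: "lip_connected K A" and B: "lip_connected K B" and p: "p \<in> A" "p \<in> B"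
    and K: "0 \<le> K" and M: "1 \<le> M"
    and le: "\<And>a b. a \<in> A \<Longrightarrow> b \<in> B \<Longrightarrow> dist a p \<le> M * dist a b \<and> dist p b \<le> M * dist a b"
  shows "lip_connected (2 * (K * M)) (A \<union> B)"
proof -
  have cross: "lip_joined (A \<union> B) (2 * (K * M) * dist a b) a b" if ab: "a \<in> A" "b \<in> B" for a b
  proof -
    have "K * dist a p \<le> K * (M * dist a b)" "K * dist p b \<le> K * (M * dist a b)"
      using le[OF ab] K by (simp_all add: mult_left_mono)
    moreover have "lip_joined A (K * dist a p) a p" "lip_joined B (K * dist p b) p b"
      using A B ab p unfolding lip_connected_def by blast+
    ultimately have "lip_joined (A \<union> B) (K * (M * dist a b)) a p"
      "lip_joined (A \<union> B) (K * (M * dist a b)) p b"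
      by (meson Un_upper1 Un_upper2 lip_joined_mono)+
    then show ?thesis
      by (auto dest: lip_joined_trans simp: mult.assoc)
  qed
  have "K * 1 \<le> 2 * (K * M)"
    using mult_left_mono[OF M K] K M by simp
  then have "K * dist a b \<le> 2 * (K * M) * dist a b" for a b :: 'a
    by (intro mult_right_mono) auto
  then have "lip_joined (A \<union> B) (2 * (K * M) * dist a b) a b"
    if "a \<in> A \<and> b \<in> A \<or> a \<in> B \<and> b \<in> B" for a b
    using A B that unfolding lip_connected_def
    by (meson Un_upper1 Un_upper2 lip_joined_mono)
  with cross show ?thesis
    unfolding lip_connected_def by (metis Un_iff dist_commute lip_joined_sym)
qed

section \<open>Chords and arcs of circles in the complex plane\<close>

lemma norm_cis_diff: "norm (cis s - cis t) = 2 * \<bar>sin ((s - t) / 2)\<bar>"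
proof -
  have "cis s - cis t = cis t * (exp (\<i> * of_real (s - t)) - 1)"
    by (simp add: cis_conv_exp right_diff_distrib algebra_simps flip: exp_add)
  then show ?thesis
    by (simp only: norm_mult norm_cis dist_exp_i_1)
qed

text \<open>A crude form of Jordan's inequality, read off from the Taylor expansion of the sine with
  cubic remainder.\<close>

lemma abs_le_2_abs_sin:
  assumes "\<bar>x\<bar> \<le> pi / 2"
  shows "\<bar>x\<bar> \<le> 2 * \<bar>sin x\<bar>"
proof -
  have "\<bar>sin x - x\<bar> \<le> \<bar>x\<bar> ^ 3 / 6"
    using Maclaurin_sin_bound[of x 3]
    by (simp add: sin_coeff_def eval_nat_numeral field_simps)
  \<comment> \<open>The number \<open>1.6\<close> exceeds \<open>pi / 2\<close> and its square is
    below 3, so the remainder is at most half of \<open>\<bar>x\<bar>\<close>.\<close>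
  moreover have "\<bar>x\<bar>\<^sup>2 \<le> 1.6\<^sup>2"
    using assms pi_less_4 pi_approx by (intro power_mono) auto
  then have "\<bar>x\<bar> * \<bar>x\<bar>\<^sup>2 \<le> \<bar>x\<bar> * 3"
    by (intro mult_left_mono) (auto simp: power2_eq_square)
  ultimately have "\<bar>sin x - x\<bar> \<le> \<bar>x\<bar> / 2"
    by (simp add: power3_eq_cube power2_eq_square mult.assoc)
  then show ?thesis
    by arith
qed

text \<open>The shorter arc between two points of a circle has length at most \<open>pi / 2\<close>
  times the chord; the bound 2 suffices here.\<close>

lemma lip_connected_sphere:
  fixes c :: complex
  assumes "0 < r"
  shows "lip_connected 2 (sphere c r)"
  unfolding lip_connected_def
proof (intro ballI)
  fix a b assume a: "a \<in> sphere c r" and b: "b \<in> sphere c r"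
  \<comment> \<open>\<open>Arg\<close> takes values between \<open>-pi\<close> and
    \<open>pi\<close>, so \<open>d\<close> is the signed angle of a shortest arc and
    \<open>d / 2\<close> is in the range of the sine estimate.\<close>
  define d where "d = Arg ((b - c) / (a - c))"
  define g where "g t = c + (a - c) * cis (t * d)" for t
  have na: "norm (a - c) = r" and nb: "norm (b - c) = r"
    using a b by (auto simp: dist_norm norm_minus_commute)
  with assms have "norm ((b - c) / (a - c)) = 1"
    by (simp add: norm_divide)
  then have "cis d = (b - c) / (a - c)"
    unfolding d_def by (metis cis_conv_exp complex_norm_eq_1_exp_eq)
  moreover have "a - c \<noteq> 0"
    using na assms by auto
  ultimately have g1: "g 1 = b"
    by (simp add: g_def)
  have diff: "g s - g t = (a - c) * (cis (s * d) - cis (t * d))" for s t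
    by (simp add: g_def algebra_simps)
  have "\<bar>d / 2\<bar> \<le> pi / 2"
    using Arg_le_pi mpi_less_Arg unfolding d_def by (simp add: abs_le_iff less_imp_le minus_le_iff)
  then have "\<bar>d\<bar> \<le> 2 * (2 * \<bar>sin (d / 2)\<bar>)"
    using abs_le_2_abs_sin[of "d / 2"] by simp
  then have "r * \<bar>d\<bar> \<le> r * (2 * (2 * \<bar>sin (d / 2)\<bar>))"
    using assms by (intro mult_left_mono) auto
  also have "\<dots> = 2 * norm (g 1 - g 0)"
    unfolding diff norm_mult norm_cis_diff by (simp add: na)
  finally have rd: "r * \<bar>d\<bar> \<le> 2 * dist a b"
    by (simp add: g1 dist_norm norm_minus_commute[of a b]) (simp add: g_def)
  have "(2 * dist a b)-lipschitz_on {0..1} g"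
  proof (rule lipschitz_onI)
    fix s t :: real
    have "dist (g s) (g t) = r * (2 * \<bar>sin ((s * d - t * d) / 2)\<bar>)"
      unfolding dist_norm diff norm_mult norm_cis_diff by (simp add: na)
    also have "\<dots> \<le> r * (2 * \<bar>(s * d - t * d) / 2\<bar>)"
      using assms by (intro mult_left_mono abs_sin_x_le_abs_x) auto
    also have "\<dots> = (r * \<bar>d\<bar>) * dist s t"
      by (simp add: dist_real_def abs_mult flip: left_diff_distrib)
    also have "\<dots> \<le> 2 * dist a b * dist s t"
      using rd by (intro mult_right_mono) auto
    finally show "dist (g s) (g t) \<le> 2 * dist a b * dist s t" .
  qed simp
  moreover have "g ` {0..1} \<subseteq> sphere c r"
    by (auto simp: g_def dist_norm norm_mult na)
  ultimately show "lip_joined (sphere c r) (2 * dist a b) a b"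
    unfolding lip_joined_def using g1 by (intro exI[of _ g]) (auto simp: g_def)
qed

section \<open>The set as a horn over a plane curve\<close>

text \<open>The plane with coordinates x and z is identified with the complex numbers. Divided by
  the square of the height, a circle with diameter from \<open>y\<^sup>2 / 4\<close> to
  \<open>y\<^sup>2\<close> gets centre \<open>5/8\<close> and radius \<open>3/8\<close>.\<close>

definition glasses :: "complex set" where
  "glasses = sphere (5/8) (3/8) \<union> closed_segment (1/4) (-1/4) \<union> sphere (-5/8) (3/8)"

definition slice :: "real \<Rightarrow> complex \<Rightarrow> real^3" where
  "slice y w = vector [y\<^sup>2 * Re w, y, y\<^sup>2 * Im w]"

lemma Re_mem_sphere:
  assumes "w \<in> sphere (of_real c) r"
  shows "\<bar>Re w - c\<bar> \<le> r"
  using assms abs_Re_le_cmod[of "of_real c - w"] by (simp add: dist_norm)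

lemma mem_segment_iff:
  "w \<in> closed_segment (1/4) (-1/4) \<longleftrightarrow> Im w = 0 \<and> \<bar>Re w\<bar> \<le> 1/4" for w :: complex
proof
  assume "w \<in> closed_segment (1/4) (-1/4)"
  then obtain u where w: "w = (1 - u) *\<^sub>R (1/4) + u *\<^sub>R (-1/4)" and u: "0 \<le> u" "u \<le> 1"
    by (auto simp: closed_segment_def)
  have "Re w = 1/4 - u/2" "Im w = 0"
    by (simp_all add: w field_simps)
  with u show "Im w = 0 \<and> \<bar>Re w\<bar> \<le> 1/4"
    unfolding abs_le_iff by simp
next
  assume "Im w = 0 \<and> \<bar>Re w\<bar> \<le> 1/4"
  \<comment> \<open>The witness solves \<open>Re w = 1/4 - u/2\<close> for \<open>u\<close>.\<close>
  then show "w \<in> closed_segment (1/4) (-1/4)"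
    unfolding closed_segment_def
    by (intro CollectI exI[of _ "1/2 - 2 * Re w"]) (auto simp: complex_eq_iff field_simps)
qed

text \<open>The right circle is glued to the segment at \<open>1/4\<close>, then the left circle at
  \<open>-1/4\<close>. Real parts separate the pieces. The constants are
  \<open>2 * (2 * 2) = 8\<close> and \<open>2 * (8 * 3) = 48\<close>.\<close>

lemma lip_connected_glasses: "lip_connected 48 glasses"
proof -
  let ?A = "sphere (5/8) (3/8) :: complex set" and ?B = "sphere (-5/8) (3/8) :: complex set"
  let ?S = "closed_segment (1/4) (-1/4) :: complex set"
  have A: "1/4 \<le> Re w" if "w \<in> ?A" for w
    using Re_mem_sphere[of w "5/8" "3/8"] that unfolding abs_le_iff by simp
  have B: "Re w \<le> -1/4" if "w \<in> ?B" for w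
    using Re_mem_sphere[of w "-5/8" "3/8"] that unfolding abs_le_iff by simp
  have re: "Re a - Re b \<le> dist a b" for a b
    using complex_Re_le_cmod[of "a - b"] by (simp add: dist_norm)
  have S: "dist a b = \<bar>Re a - Re b\<bar>" if "Im a = Im b" for a b
    using that by (simp add: dist_norm cmod_def)
  have tri: "dist a p \<le> dist a b + dist p b" for a b p :: complex
    by (rule dist_triangle2)
  have "lip_connected (2 * (2 * 2)) (?A \<union> ?S)"
  proof (rule lip_connected_Un[where p = "1/4"])
    fix a b assume ab: "a \<in> ?A" "b \<in> ?S"
    \<comment> \<open>Along the segment distances are differences of real parts, and the circle lies
      to the right of \<open>1/4\<close>. So this distance is at most \<open>dist a b\<close>, and
      the triangle inequality handles the other leg.\<close>
    have "dist (1/4) b = 1/4 - Re b"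
      using ab(2)[unfolded mem_segment_iff] S[of "1/4" b] by auto
    then show "dist a (1/4) \<le> 2 * dist a b \<and> dist (1/4) b \<le> 2 * dist a b"
      using A[OF ab(1)] re[of a b] zero_le_dist[of a b] tri[of a "1/4" b]
      by (intro conjI; linarith)
  next
    show "lip_connected 2 ?S"
      by (rule lip_connected_mono[OF lip_connected_convex]) auto
  qed (auto intro: lip_connected_sphere simp: dist_norm)
  then have "lip_connected 8 (?A \<union> ?S)"
    by simp
  then have "lip_connected (2 * (8 * 3)) ((?A \<union> ?S) \<union> ?B)"
  proof (rule lip_connected_Un[where p = "-1/4", OF _ lip_connected_mono[OF lip_connected_sphere]])
    fix a b assume ab: "a \<in> ?A \<union> ?S" "b \<in> ?B"
    show "dist a (-1/4) \<le> 3 * dist a b \<and> dist (-1/4) b \<le> 3 * dist a b"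
    proof (cases "a \<in> ?S")
      case True
      then have "dist a (-1/4) = Re a + 1/4"
        using S[of a "-1/4"] unfolding mem_segment_iff by auto
      then show ?thesis
        using B[OF ab(2)] re[of a b] zero_le_dist[of a b] tri[of b "-1/4" a]
          dist_commute[of a b] dist_commute[of b "-1/4"] dist_commute[of a "-1/4"]
        by (intro conjI; linarith)
    next
      case False
      with ab have a: "a \<in> ?A" by simp
      \<comment> \<open>Points of opposite circles are at least \<open>1/2\<close> apart, so
        bounding this leg by the diameter \<open>3/4\<close> gives the ratio \<open>3/2\<close>. The
        other leg then has ratio at most \<open>5/2\<close>, which is below 3.\<close>
      have "dist (-1/4) b \<le> dist (-1/4) (-5/8 :: complex) + dist (-5/8) b"
        by (rule dist_triangle)
      also have "\<dots> = 3/4"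
        using ab(2) S[of "-1/4" "-5/8"] by simp
      finally have 1: "dist (-1/4) b \<le> 3/4" .
      show ?thesis
        using 1 A[OF a] B[OF ab(2)] re[of a b] zero_le_dist[of a b] tri[of a "-1/4" b]
        by (intro conjI; linarith)
    qed
  qed (auto simp: dist_norm mem_segment_iff)
  then show ?thesis
    by (simp add: glasses_def)
qed

section \<open>Coordinate equations for the set and its decomposition into slices\<close>

lemma norm_le_l1_3: "norm (v :: real^3) \<le> \<bar>v$1\<bar> + \<bar>v$2\<bar> + \<bar>v$3\<bar>"
  using norm_le_l1_cart[of v] by (simp add: sum_3)

lemma vector_3_eta: "vector [v$1, v$2, v$3] = (v :: 'a::zero^3)"
  by (simp add: vec_eq_iff forall_3)

lemma slice_nth [simp]:
  "slice y w $ 1 = y\<^sup>2 * Re w" "slice y w $ 2 = y" "slice y w $ 3 = y\<^sup>2 * Im w"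
  by (simp_all add: slice_def)

text \<open>The point and both ends of the diameter have the same height, so the sphere condition
  reduces to a circle in the coordinates x and z, with centre \<open>5/8 * y\<^sup>2\<close> and
  radius \<open>3/8 * y\<^sup>2\<close>.\<close>

lemma X1_iff:
  "v \<in> X1 \<longleftrightarrow> v$2 \<in> {0..1} \<and> (v$1 - 5/8 * (v$2)\<^sup>2)\<^sup>2 + (v$3)\<^sup>2 = (3/8 * (v$2)\<^sup>2)\<^sup>2"
proof -
  have "v \<in> X1 \<longleftrightarrow> v$2 \<in> {0..1} \<and>
      norm (v - midpoint (p1 (v$2)) (p2 (v$2))) = norm (p2 (v$2) - midpoint (p1 (v$2)) (p2 (v$2)))"
    unfolding X1_def mem_Collect_eq by (metis vector_3(2) vector_3_eta)
  also have "norm (v - midpoint (p1 (v$2)) (p2 (v$2))) = norm (p2 (v$2) - midpoint (p1 (v$2)) (p2 (v$2)))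
      \<longleftrightarrow> (v$1 - 5/8 * (v$2)\<^sup>2)\<^sup>2 + (v$3)\<^sup>2 = (3/8 * (v$2)\<^sup>2)\<^sup>2"
    unfolding norm_eq
    by (simp add: inner_vec_def sum_3 midpoint_def p1_def p2_def power2_eq_square field_simps)
  finally show ?thesis .
qed

lemma X2_iff:
  "v \<in> X2 \<longleftrightarrow> v$2 \<in> {0..1} \<and> (v$1 + 5/8 * (v$2)\<^sup>2)\<^sup>2 + (v$3)\<^sup>2 = (3/8 * (v$2)\<^sup>2)\<^sup>2"
proof -
  have "v \<in> X2 \<longleftrightarrow> v$2 \<in> {0..1} \<and>
      norm (v - midpoint (q1 (v$2)) (q2 (v$2))) = norm (q2 (v$2) - midpoint (q1 (v$2)) (q2 (v$2)))"
    unfolding X2_def mem_Collect_eq by (metis vector_3(2) vector_3_eta)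
  also have "norm (v - midpoint (q1 (v$2)) (q2 (v$2))) = norm (q2 (v$2) - midpoint (q1 (v$2)) (q2 (v$2)))
      \<longleftrightarrow> (v$1 + 5/8 * (v$2)\<^sup>2)\<^sup>2 + (v$3)\<^sup>2 = (3/8 * (v$2)\<^sup>2)\<^sup>2"
    unfolding norm_eq
    by (simp add: inner_vec_def sum_3 midpoint_def q1_def q2_def power2_eq_square field_simps)
  finally show ?thesis .
qed

lemma X3_iff: "v \<in> X3 \<longleftrightarrow> v$2 \<in> {0..1} \<and> v$3 = 0 \<and> \<bar>v$1\<bar> < (v$2)\<^sup>2 / 4"
proof -
  have "v \<in> X3 \<longleftrightarrow> v$3 = 0 \<and> v$1 \<in> {-1/2..1/2} \<and> v$2 \<in> {0..1} \<and> 2 * sqrt \<bar>v$1\<bar> < \<bar>v$2\<bar>"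
    unfolding X3_def mem_Collect_eq by (metis vector_3 vector_3_eta)
  also have "2 * sqrt \<bar>v$1\<bar> < \<bar>v$2\<bar> \<longleftrightarrow> sqrt (4 * \<bar>v$1\<bar>) < sqrt ((v$2)\<^sup>2)"
    by (simp add: real_sqrt_mult)
  also have "\<dots> \<longleftrightarrow> \<bar>v$1\<bar> < (v$2)\<^sup>2 / 4"
    unfolding real_sqrt_less_iff by auto
  finally have *: "v \<in> X3 \<longleftrightarrow>
      v$3 = 0 \<and> v$1 \<in> {-1/2..1/2} \<and> v$2 \<in> {0..1} \<and> \<bar>v$1\<bar> < (v$2)\<^sup>2 / 4" .
  \<comment> \<open>For the direction from right to left, the range of \<open>v$1\<close> is
    recovered from \<open>\<bar>v$1\<bar> < 1/4\<close>.\<close>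
  have "(v$2)\<^sup>2 \<le> 1" if "v$2 \<in> {0..1}"
    using that by (simp add: power_le_one)
  with * show ?thesis
    by (fastforce simp: abs_less_iff)
qed

text \<open>The strict inequality in \<^const>\<open>X3\<close> may be relaxed, because its boundary lies on the two tubes.\<close>

lemma X_iff:
  "v \<in> X1 \<union> X2 \<union> X3 \<longleftrightarrow> v$2 \<in> {0..1} \<and>
     ((v$1 - 5/8 * (v$2)\<^sup>2)\<^sup>2 + (v$3)\<^sup>2 = (3/8 * (v$2)\<^sup>2)\<^sup>2 \<or>
      (v$1 + 5/8 * (v$2)\<^sup>2)\<^sup>2 + (v$3)\<^sup>2 = (3/8 * (v$2)\<^sup>2)\<^sup>2 \<or>
      v$3 = 0 \<and> \<bar>v$1\<bar> \<le> (v$2)\<^sup>2 / 4)"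
proof -
  have "(v$1 - 5/8 * (v$2)\<^sup>2)\<^sup>2 = (3/8 * (v$2)\<^sup>2)\<^sup>2 \<or> (v$1 + 5/8 * (v$2)\<^sup>2)\<^sup>2 = (3/8 * (v$2)\<^sup>2)\<^sup>2"
    if "\<bar>v$1\<bar> = (v$2)\<^sup>2 / 4"
    using that by (cases "v$1 \<ge> 0") (auto simp: power2_eq_iff)
  then show ?thesis
    unfolding Un_iff X1_iff X2_iff X3_iff by (auto simp: order_le_less)
qed

text \<open>Closedness provides closest points in the set and in its closed parts.\<close>

lemma closed_X: "closed (X1 \<union> X2 \<union> X3)"
proof -
  have "X1 \<union> X2 \<union> X3 = {v. (0 \<le> v$2 \<and> v$2 \<le> 1) \<and>
     ((v$1 - 5/8 * (v$2)\<^sup>2)\<^sup>2 + (v$3)\<^sup>2 = (3/8 * (v$2)\<^sup>2)\<^sup>2 \<or>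
      (v$1 + 5/8 * (v$2)\<^sup>2)\<^sup>2 + (v$3)\<^sup>2 = (3/8 * (v$2)\<^sup>2)\<^sup>2 \<or>
      v$3 = 0 \<and> \<bar>v$1\<bar> \<le> (v$2)\<^sup>2 / 4)}"
    by (rule set_eqI) (simp only: X_iff mem_Collect_eq atLeastAtMost_iff)
  also have "closed \<dots>"
    by (intro closed_Collect_conj closed_Collect_disj closed_Collect_eq closed_Collect_le
          continuous_intros) simp
  finally show ?thesis .
qed

lemma mem_sphere_iff:
  assumes "0 \<le> r"
  shows "w \<in> sphere (of_real c) r \<longleftrightarrow> (Re w - c)\<^sup>2 + (Im w)\<^sup>2 = r\<^sup>2"
proof -
  have "w \<in> sphere (of_real c) r \<longleftrightarrow> (norm (w - of_real c))\<^sup>2 = r\<^sup>2"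
    using assms by (auto simp: dist_norm norm_minus_commute power2_eq_iff_nonneg)
  then show ?thesis
    by (simp add: cmod_power2)
qed

lemma glasses_iff:
  "w \<in> glasses \<longleftrightarrow> (Re w - 5/8)\<^sup>2 + (Im w)\<^sup>2 = (3/8)\<^sup>2 \<or> (Re w + 5/8)\<^sup>2 + (Im w)\<^sup>2 = (3/8)\<^sup>2 \<or>
     Im w = 0 \<and> \<bar>Re w\<bar> \<le> 1/4"
  using mem_sphere_iff[of "3/8" w "5/8"] mem_sphere_iff[of "3/8" w "-5/8"]
  unfolding glasses_def Un_iff mem_segment_iff by auto

text \<open>Every condition in \<open>X_iff\<close> is homogeneous in the scale
  \<open>y\<^sup>2\<close>, which cancels away from the tip.\<close>

lemma slice_mem_X_iff:
  assumes "y \<in> {0..1}" "y \<noteq> 0"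
  shows "slice y w \<in> X1 \<union> X2 \<union> X3 \<longleftrightarrow> w \<in> glasses"
proof -
  have "(y\<^sup>2 * Re w - 5/8 * y\<^sup>2)\<^sup>2 + (y\<^sup>2 * Im w)\<^sup>2 = (y\<^sup>2)\<^sup>2 * ((Re w - 5/8)\<^sup>2 + (Im w)\<^sup>2)"
    "(y\<^sup>2 * Re w + 5/8 * y\<^sup>2)\<^sup>2 + (y\<^sup>2 * Im w)\<^sup>2 = (y\<^sup>2)\<^sup>2 * ((Re w + 5/8)\<^sup>2 + (Im w)\<^sup>2)"
    "(3/8 * y\<^sup>2)\<^sup>2 = (y\<^sup>2)\<^sup>2 * (3/8)\<^sup>2"
    by (simp_all add: power2_eq_square algebra_simps)
  moreover have "(y\<^sup>2)\<^sup>2 * s = (y\<^sup>2)\<^sup>2 * t \<longleftrightarrow> s = t" "y\<^sup>2 * s = 0 \<longleftrightarrow> s = 0" for s t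
    using assms(2) by simp_all
  moreover have "\<bar>y\<^sup>2 * Re w\<bar> \<le> y\<^sup>2 / 4 \<longleftrightarrow> \<bar>Re w\<bar> \<le> 1/4"
    using assms(2) by (simp add: abs_mult field_simps)
  ultimately show ?thesis
    using assms(1) by (simp only: X_iff glasses_iff slice_nth simp_thms)
qed

lemma X_eq_slices: "X1 \<union> X2 \<union> X3 = (\<Union>y\<in>{0..1}. slice y ` glasses)"
proof (intro equalityI subsetI)
  fix v assume v: "v \<in> X1 \<union> X2 \<union> X3"
  define y where "y = v$2"
  have y: "y \<in> {0..1}"
    using v unfolding X_iff y_def by blast
  have "\<exists>w\<in>glasses. v = slice y w"
  proof (cases "y = 0")
    case True
    \<comment> \<open>At height 0 the set is only the origin, and the point 0 of the middle segment
      serves as preimage.\<close>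
    with v have "v$1 = 0" "v$3 = 0"
      unfolding X_iff y_def by auto
    with True have "v = slice y 0"
      by (simp add: y_def vec_eq_iff forall_3)
    then show ?thesis
      by (intro bexI[of _ 0]) (auto simp: glasses_iff)
  next
    case False
    define w where "w = Complex (v$1 / y\<^sup>2) (v$3 / y\<^sup>2)"
    have "v = slice y w"
      using False by (simp add: vec_eq_iff forall_3 w_def y_def)
    with v y False show ?thesis
      using slice_mem_X_iff by blast
  qed
  with y show "v \<in> (\<Union>y\<in>{0..1}. slice y ` glasses)"
    by blast
next
  fix v assume "v \<in> (\<Union>y\<in>{0..1}. slice y ` glasses)"
  then obtain y w where y: "y \<in> {0..1}" and w: "w \<in> glasses" and v: "v = slice y w"
    by blast
  show "v \<in> X1 \<union> X2 \<union> X3"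
  proof (cases "y = 0")
    case True
    then show ?thesis
      unfolding X_iff v by simp
  qed (use y w v slice_mem_X_iff in blast)
qed

section \<open>Lipschitz estimates for the sweep\<close>

lemma glasses_bound:
  assumes "w \<in> glasses"
  shows "\<bar>Re w\<bar> \<le> 1" "\<bar>Im w\<bar> \<le> 1"
proof -
  have "norm w \<le> 1"
  proof -
    consider "w \<in> sphere (5/8) (3/8)" | "w \<in> closed_segment (1/4) (-1/4)" | "w \<in> sphere (-5/8) (3/8)"
      using assms by (auto simp: glasses_def)
    then show ?thesis
    proof cases
      case 1
      then show ?thesis
        using norm_triangle_sub[of w "5/8"] by (simp add: dist_norm norm_minus_commute)
    next
      case 2
      then show ?thesis
        using cmod_le[of w] unfolding mem_segment_iff by auto
    next
      case 3
      then show ?thesis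
        using norm_triangle_sub[of w "-5/8"] norm_minus_commute[of w "-5/8"] by (simp add: dist_norm)
    qed
  qed
  then show "\<bar>Re w\<bar> \<le> 1" "\<bar>Im w\<bar> \<le> 1"
    using abs_Re_le_cmod[of w] abs_Im_le_cmod[of w] by linarith+
qed

lemma abs_diff_power2_le:
  assumes "s \<in> {0..1}" "t \<in> {0..1::real}"
  shows "\<bar>s\<^sup>2 - t\<^sup>2\<bar> \<le> 2 * \<bar>s - t\<bar>"
proof -
  have "\<bar>s\<^sup>2 - t\<^sup>2\<bar> = \<bar>s + t\<bar> * \<bar>s - t\<bar>"
    by (simp add: power2_eq_square algebra_simps flip: abs_mult)
  also have "\<dots> \<le> 2 * \<bar>s - t\<bar>"
    using assms by (intro mult_right_mono) auto
  finally show ?thesis .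
qed

text \<open>The height contributes 1 and the other two coordinates contribute 2 each, since squaring
  is 2-Lipschitz on the unit interval and \<open>w\<close> has coordinates at most 1.\<close>

lemma lipschitz_slice_height:
  assumes "w \<in> glasses"
  shows "5-lipschitz_on {0..1} (\<lambda>y. slice y w)"
proof (rule lipschitz_onI)
  fix s t :: real assume st: "s \<in> {0..1}" "t \<in> {0..1}"
  have "\<bar>s\<^sup>2 - t\<^sup>2\<bar> * \<bar>Re w\<bar> \<le> (2 * \<bar>s - t\<bar>) * 1" "\<bar>s\<^sup>2 - t\<^sup>2\<bar> * \<bar>Im w\<bar> \<le> (2 * \<bar>s - t\<bar>) * 1"
    using abs_diff_power2_le[OF st] glasses_bound[OF assms] by (intro mult_mono; simp)+
  then show "dist (slice s w) (slice t w) \<le> 5 * dist s t"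
    using norm_le_l1_3[of "slice s w - slice t w"]
    by (simp add: dist_norm abs_mult flip: left_diff_distrib)
qed simp

lemma lipschitz_slice: "(2 * y\<^sup>2)-lipschitz_on UNIV (slice y)"
proof (rule lipschitz_onI)
  fix v w :: complex
  have "\<bar>y\<^sup>2 * Re v - y\<^sup>2 * Re w\<bar> = y\<^sup>2 * \<bar>Re (v - w)\<bar>" "\<bar>y\<^sup>2 * Im v - y\<^sup>2 * Im w\<bar> = y\<^sup>2 * \<bar>Im (v - w)\<bar>"
    by (simp_all add: abs_mult flip: right_diff_distrib)
  moreover have "y\<^sup>2 * \<bar>Re (v - w)\<bar> \<le> y\<^sup>2 * norm (v - w)" "y\<^sup>2 * \<bar>Im (v - w)\<bar> \<le> y\<^sup>2 * norm (v - w)"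
    by (intro mult_left_mono abs_Re_le_cmod abs_Im_le_cmod; simp)+
  ultimately show "dist (slice y v) (slice y w) \<le> 2 * y\<^sup>2 * dist v w"
    using norm_le_l1_3[of "slice y v - slice y w"] by (simp add: dist_norm)
qed simp

text \<open>Moving inside the slice at height \<open>y'\<close> is no longer than a multiple of the
  whole distance. Passing from \<open>slice y w\<close> to \<open>slice y' w\<close> changes the x
  and z coordinates by at most twice the height difference, so each of them differs by at most three
  times the distance \<open>?D\<close>.\<close>

lemma dist_slice_lower:
  assumes y: "y \<in> {0..1}" "y' \<in> {0..1}" and w: "w \<in> glasses"
  shows "y'\<^sup>2 * dist w w' \<le> 6 * dist (slice y w) (slice y' w')"
proof -
  let ?D = "dist (slice y w) (slice y' w')"
  have D: "\<bar>y\<^sup>2 * Re w - y'\<^sup>2 * Re w'\<bar> \<le> ?D" "\<bar>y - y'\<bar> \<le> ?D" "\<bar>y\<^sup>2 * Im w - y'\<^sup>2 * Im w'\<bar> \<le> ?D"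
    using component_le_norm_cart[of "slice y w - slice y' w'" 1]
      component_le_norm_cart[of "slice y w - slice y' w'" 2]
      component_le_norm_cart[of "slice y w - slice y' w'" 3] by (simp_all add: dist_norm)
  have "2 * \<bar>y' - y\<bar> * 1 \<le> 2 * ?D"
    using D(2) by (simp add: abs_minus_commute)
  have "\<bar>y'\<^sup>2 - y\<^sup>2\<bar> * \<bar>Re w\<bar> \<le> (2 * \<bar>y' - y\<bar>) * 1" "\<bar>y'\<^sup>2 - y\<^sup>2\<bar> * \<bar>Im w\<bar> \<le> (2 * \<bar>y' - y\<bar>) * 1"
    using abs_diff_power2_le[OF y(2,1)] glasses_bound[OF w] by (intro mult_mono; simp)+
  then have "\<bar>(y'\<^sup>2 - y\<^sup>2) * Re w\<bar> \<le> 2 * ?D" "\<bar>(y'\<^sup>2 - y\<^sup>2) * Im w\<bar> \<le> 2 * ?D"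
    using \<open>2 * \<bar>y' - y\<bar> * 1 \<le> 2 * ?D\<close> unfolding abs_mult by (meson order_trans)+
  moreover have "y'\<^sup>2 * Re (w - w') = (y'\<^sup>2 - y\<^sup>2) * Re w + (y\<^sup>2 * Re w - y'\<^sup>2 * Re w')"
    "y'\<^sup>2 * Im (w - w') = (y'\<^sup>2 - y\<^sup>2) * Im w + (y\<^sup>2 * Im w - y'\<^sup>2 * Im w')"
    by (simp_all add: algebra_simps)
  ultimately have "\<bar>y'\<^sup>2 * Re (w - w')\<bar> \<le> 3 * ?D" "\<bar>y'\<^sup>2 * Im (w - w')\<bar> \<le> 3 * ?D"
    using D by linarith+
  moreover have "y'\<^sup>2 * norm (w - w') \<le> y'\<^sup>2 * (\<bar>Re (w - w')\<bar> + \<bar>Im (w - w')\<bar>)"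
    by (intro mult_left_mono cmod_le) auto
  ultimately show ?thesis
    by (simp add: abs_mult dist_norm distrib_left)
qed

lemma lip_connected_X: "lip_connected 1152 (X1 \<union> X2 \<union> X3)"
  unfolding lip_connected_def X_eq_slices
proof (intro ballI)
  let ?X = "\<Union>y\<in>{0..1}. slice y ` glasses"
  fix a b assume "a \<in> ?X" "b \<in> ?X"
  then obtain y w y' w' where y: "y \<in> {0..1}" "y' \<in> {0..1}" and w: "w \<in> glasses" "w' \<in> glasses"
    and a: "a = slice y w" and b: "b = slice y' w'"
    by blast
  have "dist y y' \<le> dist a b"
    using component_le_norm_cart[of "a - b" 2] by (simp add: a b dist_norm)
  \<comment> \<open>The first leg changes only the height. Its bound is raised to that of the second
    leg so that both can be concatenated.\<close>
  then have "5 * (1 * dist y y') \<le> 576 * dist a b"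
    using zero_le_dist[of a b] by linarith
  moreover have "lip_joined ?X (5 * (1 * dist y y')) (slice y w) (slice y' w)"
    using y w(1) lip_connected_convex[of "{0..1::real}"] unfolding lip_connected_def
    by (intro lip_joined_image[OF _ lipschitz_slice_height]) auto
  ultimately have 1: "lip_joined ?X (576 * dist a b) a (slice y' w)"
    unfolding a by (blast intro: lip_joined_mono)
  \<comment> \<open>The constant is \<open>576 = 2 * 48 * 6\<close>, from
    \<open>lipschitz_slice\<close>, \<open>lip_connected_glasses\<close> and
    \<open>dist_slice_lower\<close>.\<close>
  have "2 * y'\<^sup>2 * (48 * dist w w') \<le> 576 * dist a b"
    using dist_slice_lower[OF y w(1), of w'] by (simp add: a b mult.commute)
  moreover have "lip_joined ?X (2 * y'\<^sup>2 * (48 * dist w w')) (slice y' w) (slice y' w')"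
    using y w lip_connected_glasses lipschitz_on_subset[OF lipschitz_slice] unfolding lip_connected_def
    by (intro lip_joined_image[where S = glasses and f = "slice y'"]) auto
  ultimately have "lip_joined ?X (576 * dist a b) (slice y' w) b"
    unfolding b by (blast intro: lip_joined_mono)
  from lip_joined_trans[OF 1 this] show "lip_joined ?X (1152 * dist a b) a b"
    by simp
qed

section \<open>Points of the medial axis inside the tubes\<close>

lemma closest_points_isometry:
  assumes f: "\<And>a b. dist (f a) (f b) = dist a b" and X: "f ` X = X" and a: "a \<in> closest_points X p"
  shows "f a \<in> closest_points X (f p)"
proof -
  have "infdist (f p) (f ` X) = infdist p X"
    by (simp add: infdist_def f image_image)
  with a X f show ?thesis
    by (auto simp: closest_points_def)
qed

lemma medial_axis_isometry:
  assumes f: "\<And>a b. dist (f a) (f b) = dist a b" and X: "f ` X = X" and p: "p \<in> medial_axis X"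
  shows "f p \<in> medial_axis X"
proof -
  have "inj f"
    by (metis f dist_eq_0_iff injI)
  then have "f p \<notin> X"
    using p X inj_image_mem_iff[of f p X] by (auto simp: medial_axis_def)
  with p \<open>inj f\<close> show ?thesis
    unfolding medial_axis_def by (blast intro: closest_points_isometry[OF f X] dest: injD)
qed

text \<open>\<open>flip_x\<close> exchanges the two tubes and carries medial axis points from one to
  the other. \<open>flip_z\<close> fixes the plane \<open>z = 0\<close> and produces second closest
  points.\<close>

definition flip_x :: "real^3 \<Rightarrow> real^3" where "flip_x v = vector [- v$1, v$2, v$3]"
definition flip_z :: "real^3 \<Rightarrow> real^3" where "flip_z v = vector [v$1, v$2, - v$3]"

lemma flip_nth [simp]:
  "flip_x v $ 1 = - v$1" "flip_x v $ 2 = v$2" "flip_x v $ 3 = v$3"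
  "flip_z v $ 1 = v$1" "flip_z v $ 2 = v$2" "flip_z v $ 3 = - v$3"
  by (simp_all add: flip_x_def flip_z_def)

lemma dist_flip: "dist (flip_x a) (flip_x b) = dist a b" "dist (flip_z a) (flip_z b) = dist a b"
  unfolding dist_norm norm_eq by (simp_all add: inner_vec_def sum_3 algebra_simps)

lemma flip_X:
  "flip_x ` (X1 \<union> X2 \<union> X3) = X1 \<union> X2 \<union> X3" "flip_z ` (X1 \<union> X2 \<union> X3) = X1 \<union> X2 \<union> X3"
proof -
  have sq: "(- a - b)\<^sup>2 = (a + b)\<^sup>2" "(- a + b)\<^sup>2 = (a - b)\<^sup>2" for a b :: real
    by (simp_all add: power2_eq_square algebra_simps)
  have inv: "flip_x (flip_x v) = v" "flip_z (flip_z v) = v" for v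
    by (simp_all add: vec_eq_iff forall_3)
  have "flip_x v \<in> X1 \<union> X2 \<union> X3" "flip_z v \<in> X1 \<union> X2 \<union> X3" if "v \<in> X1 \<union> X2 \<union> X3" for v
    using that unfolding X_iff flip_nth sq by auto
  then show "flip_x ` (X1 \<union> X2 \<union> X3) = X1 \<union> X2 \<union> X3" "flip_z ` (X1 \<union> X2 \<union> X3) = X1 \<union> X2 \<union> X3"
    \<comment> \<open>Both maps are involutions, so mapping the set into itself already gives
      equality.\<close>
    by (metis (no_types, lifting) equalityI image_subsetI inv rev_image_eqI subsetI)+
qed

text \<open>A centre of the right tube has distance 0 from its own axis and
  \<open>5/4 * y\<^sup>2\<close> from that of the left tube, neither equal to the radius, and it
  lies beyond the end of the segment.\<close>

lemma mid_tube_not_in_X: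
  assumes v1: "v$1 = 5/8 * (v$2)\<^sup>2" and "v$2 \<noteq> 0" "v$3 = 0"
  shows "v \<notin> X1 \<union> X2 \<union> X3"
proof -
  have pos: "0 < (v$2)\<^sup>2"
    using assms(2) by simp
  have "0 < (3/8 * (v$2)\<^sup>2)\<^sup>2" "(3/8 * (v$2)\<^sup>2)\<^sup>2 < (5/4 * (v$2)\<^sup>2)\<^sup>2"
    using pos by (intro zero_less_power power_strict_mono; simp)+
  moreover have "v$1 - 5/8 * (v$2)\<^sup>2 = 0" "v$1 + 5/8 * (v$2)\<^sup>2 = 5/4 * (v$2)\<^sup>2"
    "\<not> \<bar>v$1\<bar> \<le> (v$2)\<^sup>2 / 4"
    using v1 pos by linarith+
  ultimately show ?thesis
    using assms(3) unfolding X_iff by (simp only:) simp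
qed

text \<open>Cut the set along the middle of the right tube into closed parts \<open>L\<close> and \<open>R\<close>. On the
  diameter of the tube at height \<open>y\<close> the intermediate value theorem gives a point equidistant from
  both. If its closest points in \<open>L\<close> and \<open>R\<close> coincide, they lie on the cut, hence off the plane
  \<open>z = 0\<close>, and reflecting in this plane gives a second closest point.\<close>

lemma medial_axis_in_tube:
  assumes y: "0 < y" "y < 1"
  obtains x where "vector [x, y, 0] \<in> medial_axis (X1 \<union> X2 \<union> X3)" "y\<^sup>2 / 4 < x" "x < y\<^sup>2"
proof -
  let ?X = "X1 \<union> X2 \<union> X3"
  define L where "L = ?X \<inter> {v. v$1 \<le> 5/8 * (v$2)\<^sup>2}"
  define R where "R = ?X \<inter> {v. 5/8 * (v$2)\<^sup>2 \<le> v$1}"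
  define P :: "real \<Rightarrow> real^3" where "P x = vector [0, y, 0] + x *\<^sub>R axis 1 1" for x
  have P_nth [simp]: "P x $ 1 = x" "P x $ 2 = y" "P x $ 3 = 0" for x
    by (simp_all add: P_def axis_def)
  have P_eq: "P x = vector [x, y, 0]" for x
    by (simp add: vec_eq_iff forall_3)
  have y2: "0 < y\<^sup>2" "y\<^sup>2 < y"
    using y by (simp_all add: power2_eq_square)
  have closed: "closed L" "closed R"
    unfolding L_def R_def
    by (intro closed_Int closed_X closed_Collect_le continuous_intros)+
  have PX: "P x \<in> ?X" if "x = y\<^sup>2 / 4 \<or> x = y\<^sup>2" for x
  proof -
    have "y\<^sup>2 - 5/8 * y\<^sup>2 = 3/8 * y\<^sup>2"
      by simp
    moreover have "\<bar>x\<bar> = x"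
      using that y2 by (intro abs_of_nonneg) linarith
    ultimately show ?thesis
      using that y unfolding X_iff by auto
  qed
  have PL: "P (y\<^sup>2 / 4) \<in> L" and PR: "P (y\<^sup>2) \<in> R"
    using PX by (simp_all add: L_def R_def)
  have mid: "P (5/8 * y\<^sup>2) \<notin> ?X"
    using y by (intro mid_tube_not_in_X) auto
  let ?f = "\<lambda>x. infdist (P x) L - infdist (P x) R"
  have "continuous_on {y\<^sup>2 / 4..y\<^sup>2} ?f"
    unfolding P_def by (intro continuous_intros)
  moreover have "?f (y\<^sup>2 / 4) \<le> 0" "0 \<le> ?f (y\<^sup>2)"
    using PL PR by (simp_all add: infdist_nonneg)
  ultimately obtain x where x: "y\<^sup>2 / 4 \<le> x" "x \<le> y\<^sup>2" and fx: "?f x = 0"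
    using IVT'[of ?f "y\<^sup>2 / 4" 0 "y\<^sup>2"] y2 by auto
  define d where "d = infdist (P x) L"
  have dR: "d = infdist (P x) R"
    using fx by (simp add: d_def)
  have "?X = L \<union> R"
    by (auto simp: L_def R_def)
  then have dX: "infdist (P x) ?X = d"
    using PL PR infdist_Un_min[of L R "P x"] by (metis dR d_def empty_iff min.idem)
  \<comment> \<open>Distance 0 would place \<open>P x\<close> in both closed parts, hence at the
    centre of the tube, which is off the set.\<close>
  have "d \<noteq> 0"
  proof
    assume "d = 0"
    then have "P x \<in> L" "P x \<in> R"
      using closed PL PR dR d_def in_closed_iff_infdist_zero by (metis empty_iff)+
    then have "x = 5/8 * y\<^sup>2" "P x \<in> ?X"
      by (auto simp: L_def R_def)
    with mid show False by blast
  qed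
  then have PxX: "P x \<notin> ?X"
    using dX by auto
  obtain l where l: "l \<in> L" "d = dist (P x) l"
    using infdist_attains_inf[OF closed(1)] PL d_def by (metis empty_iff)
  obtain r where r: "r \<in> R" "d = dist (P x) r"
    using infdist_attains_inf[OF closed(2)] PR dR by (metis empty_iff)
  have lc: "l \<in> closest_points ?X (P x)" and rc: "r \<in> closest_points ?X (P x)"
    using l r dX unfolding closest_points_def L_def R_def by (simp_all add: dist_commute)
  have "\<exists>b \<in> closest_points ?X (P x). l \<noteq> b"
  proof (cases "l = r")
    case True
    with l r have l1: "l$1 = 5/8 * (l$2)\<^sup>2" and lX: "l \<in> ?X"
      by (auto simp: L_def R_def)
    \<comment> \<open>A common closest point might still be the origin, where the cut meets the
      plane \<open>z = 0\<close>. This is excluded because the origin is at least \<open>y\<close>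
      away while \<open>d < y\<close>.\<close>
    have "d \<le> dist (P x) (P (y\<^sup>2))"
      using dX PX infdist_le by metis
    also have "\<dots> \<le> y\<^sup>2 - x"
      using norm_le_l1_3[of "P x - P (y\<^sup>2)"] x by (simp add: dist_norm)
    finally have "d < y"
      using x y2 by linarith
    moreover have "\<bar>y - l$2\<bar> \<le> d"
      using component_le_norm_cart[of "P x - l" 2] l(2) by (simp add: dist_norm)
    ultimately have "l$2 \<noteq> 0"
      by auto
    with l1 lX have "l$3 \<noteq> 0"
      using mid_tube_not_in_X by blast
    then have "l \<noteq> flip_z l"
      by (metis flip_nth(6) equal_neg_zero)
    moreover have "flip_z (P x) = P x"
      by (simp add: vec_eq_iff forall_3)
    ultimately show ?thesis
      using closest_points_isometry[OF dist_flip(2) flip_X(2) lc] by metis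
  qed (use rc in blast)
  with lc PxX have "P x \<in> medial_axis ?X"
    unfolding medial_axis_def by blast
  moreover have "x \<noteq> y\<^sup>2 / 4" "x \<noteq> y\<^sup>2"
    using PxX PX by auto
  ultimately show ?thesis
    using that x P_eq by force
qed

section \<open>Lower bounds for paths leaving a tube\<close>

lemma dist_le_path_length:
  assumes "t \<in> {0..1}"
  shows "ennreal (dist (g 0) (g t)) \<le> path_length g"
proof -
  \<comment> \<open>The first edge of the inscribed polygon through \<open>g 0\<close>,
    \<open>g t\<close> and \<open>g 1\<close> gives the bound.\<close>
  let ?t = "\<lambda>i::nat. if i = 0 then 0 else if i = 1 then t else 1"
  have "partition01 2 ?t"
    using assms by (auto simp: partition01_def less_2_cases_iff)
  then have "(\<Sum>i<2. ennreal (dist (g (?t i)) (g (?t (Suc i))))) \<le> path_length g"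
    unfolding path_length_def by (intro SUP_upper2[of "(2, ?t)"]) auto
  moreover have "ennreal (dist (g 0) (g t)) \<le> (\<Sum>i<2. ennreal (dist (g (?t i)) (g (?t (Suc i)))))"
    by (simp add: numeral_2_eq_2)
  ultimately show ?thesis
    by (rule order_trans[rotated])
qed

text \<open>The interior of the right tube. Strict bounds on the height make it open and put the end
  disc at height 1 into its frontier.\<close>

definition tube :: "(real^3) set" where
  "tube = {v. (0 < v$2 \<and> v$2 < 1) \<and> (v$1 - 5/8 * (v$2)\<^sup>2)\<^sup>2 + (v$3)\<^sup>2 < (3/8 * (v$2)\<^sup>2)\<^sup>2}"

text \<open>A frontier point satisfies the weak inequalities but not all strict ones. Equality in
  the quadratic one, or height 0, would put it on the set, so only height 1 remains.\<close>

lemma frontier_tube: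
  assumes "v \<in> frontier tube" "v \<notin> X1 \<union> X2 \<union> X3"
  shows "v$2 = 1"
proof -
  let ?C = "{v::real^3. (0 \<le> v$2 \<and> v$2 \<le> 1) \<and> (v$1 - 5/8 * (v$2)\<^sup>2)\<^sup>2 + (v$3)\<^sup>2 \<le> (3/8 * (v$2)\<^sup>2)\<^sup>2}"
  have "open tube"
    unfolding tube_def by (intro open_Collect_conj open_Collect_less continuous_intros)
  moreover have "closed ?C"
    by (intro closed_Collect_conj closed_Collect_le continuous_intros)
  then have "closure tube \<subseteq> ?C"
    by (intro closure_minimal) (auto simp: tube_def)
  ultimately have C: "v \<in> ?C" and "v \<notin> tube"
    using assms(1) by (auto simp: frontier_def interior_open)
  moreover have "v$2 \<noteq> 0"
  proof
    assume "v$2 = 0"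
    with C have "v$1 = 0" "v$3 = 0"
      by (auto simp: sum_power2_le_zero_iff)
    with \<open>v$2 = 0\<close> assms(2) show False
      unfolding X_iff by simp
  qed
  moreover have "(v$1 - 5/8 * (v$2)\<^sup>2)\<^sup>2 + (v$3)\<^sup>2 \<noteq> (3/8 * (v$2)\<^sup>2)\<^sup>2"
    using C assms(2) unfolding X_iff by auto
  ultimately show ?thesis
    by (auto simp: tube_def)
qed

text \<open>The image of a path is connected, so it meets the frontier of the tube. Off the set this
  happens only at height 1, and the path is at least as long as the climb to that height.\<close>

lemma length_dist_leaving_tube:
  assumes "a \<in> tube" "b \<notin> tube" "Y \<inter> (X1 \<union> X2 \<union> X3) = {}"
  shows "ennreal (1 - a$2) \<le> length_dist Y a b"
  unfolding length_dist_def
proof (rule INF_greatest)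
  fix g assume "g \<in> {g. rectifiable_path g \<and> path_image g \<subseteq> Y \<and> pathstart g = a \<and> pathfinish g = b}"
  then have g: "path g" "path_image g \<subseteq> Y" "g 0 = a" "g 1 = b"
    by (auto simp: rectifiable_path_def pathstart_def pathfinish_def)
  have "g 0 \<in> path_image g" "g 1 \<in> path_image g"
    by (auto simp: path_image_def)
  with g assms obtain v where v: "v \<in> path_image g" "v \<in> frontier tube"
    using connected_Int_frontier[OF connected_path_image[OF g(1)], of tube] by blast
  with g(2) assms(3) have "v$2 = 1"
    by (intro frontier_tube) auto
  obtain t where t: "t \<in> {0..1}" "v = g t"
    using v(1) by (auto simp: path_image_def)
  have "1 - a$2 \<le> dist a v"
    using component_le_norm_cart[of "a - v" 2] \<open>v$2 = 1\<close> by (simp add: dist_norm)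
  then show "ennreal (1 - a$2) \<le> path_length g"
    using dist_le_path_length[OF t(1), of g] t(2) g(3) by (meson ennreal_leI order_trans)
qed

lemma not_lipschitz_normally_embedded_medial_axis:
  "\<not> lipschitz_normally_embedded (medial_axis (X1 \<union> X2 \<union> X3))"
proof
  let ?M = "medial_axis (X1 \<union> X2 \<union> X3)"
  assume "lipschitz_normally_embedded ?M"
  then obtain C where C: "0 < C"
    "\<And>a b. a \<in> ?M \<Longrightarrow> b \<in> ?M \<Longrightarrow> length_dist ?M a b \<le> ennreal (C * dist a b)"
    unfolding lipschitz_normally_embedded_def by blast
  \<comment> \<open>This choice makes both \<open>y\<close> and \<open>C * y\<close> smaller than
    \<open>1/4\<close>. The upper bound \<open>2 * (C * y) * y\<close> is then at most
    \<open>1/8\<close>, whereas \<open>1 - y\<close> exceeds \<open>3/4\<close>.\<close>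
  define y where "y = 1 / (4 * (C + 1))"
  have y: "0 < y" "y < 1/4" and Cy: "C * y < 1/4"
    using C(1) by (simp_all add: y_def field_simps)
  obtain x where x: "vector [x, y, 0] \<in> ?M" "y\<^sup>2 / 4 < x" "x < y\<^sup>2"
    using medial_axis_in_tube[of y] y by auto
  define a :: "real^3" where "a = vector [x, y, 0]"
  have a [simp]: "a$1 = x" "a$2 = y" "a$3 = 0"
    by (simp_all add: a_def)
  have "\<not> \<bar>3/8 * y\<^sup>2\<bar> \<le> \<bar>x - 5/8 * y\<^sup>2\<bar>"
    using x by linarith
  then have "a \<in> tube"
    using y unfolding abs_le_square_iff not_le by (simp add: tube_def)
  \<comment> \<open>The mirror image has negative first coordinate, so its distance from the axis of
    the right tube exceeds the radius.\<close>
  moreover have "\<bar>3/8 * y\<^sup>2\<bar> \<le> \<bar>- x - 5/8 * y\<^sup>2\<bar>"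
    using x y by simp
  then have "flip_x a \<notin> tube"
    unfolding abs_le_square_iff by (simp add: tube_def)
  moreover have "?M \<inter> (X1 \<union> X2 \<union> X3) = {}"
    by (auto simp: medial_axis_def)
  ultimately have "ennreal (1 - y) \<le> length_dist ?M a (flip_x a)"
    using length_dist_leaving_tube[of a "flip_x a" ?M] by simp
  also have "\<dots> \<le> ennreal (C * dist a (flip_x a))"
    using x(1) medial_axis_isometry[OF dist_flip(1) flip_X(1)] by (intro C(2)) (auto simp: a_def)
  finally have "1 - y \<le> C * dist a (flip_x a)"
    using C(1) by simp
  also have "dist a (flip_x a) \<le> 2 * y\<^sup>2"
    using norm_le_l1_3[of "a - flip_x a"] x y by (simp add: dist_norm)
  then have "C * dist a (flip_x a) \<le> C * (2 * y\<^sup>2)"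
    using C(1) by (intro mult_left_mono) auto
  also have "\<dots> = 2 * (C * y) * y"
    by (simp add: power2_eq_square)
  also have "\<dots> \<le> 2 * (1/4) * (1/4)"
    using y Cy C(1) by (intro mult_mono) auto
  finally show False
    using y by simp
qed

theorem proposition4p4:
  fixes X :: "(real^3) set"
  defines "X \<equiv> X1 \<union> X2 \<union> X3"
  shows "lipschitz_normally_embedded X \<and> \<not> lipschitz_normally_embedded (medial_axis X)"
  unfolding X_def
  using lip_connected_imp_lipschitz_normally_embedded[OF lip_connected_X]
    not_lipschitz_normally_embedded_medial_axis by simp

end
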